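(* Let $\mathbb{K}$ be an algebraically closed field, let $G=(V,A)$ be a connected simple directed graph on vertices $V=\{1,\dots,n\}$ with $n\geq 3$, assume that the characteristic of $\mathbb{K}$ is relatively prime to $n$, and let $\omega\in\mathbb{K}$ be a primitive $n$-th root of unity. Then the graph $G$ is uniquely Hamiltonian if and only if the Hamiltonian ideal $H_G$ is of the form $H_{G,C}$ for some length $n$ cycle $C$.
   Context: $\delta^+(i)$ is the set of vertices $j$ with $(i,j)\in A$; both $(i,j)$ and $(j,i)$ may belong to $A$. The Hamiltonian ideal $H_G\subseteq\mathbb{K}[x_1,\dots,x_n]$ is generated by the polynomials $x_i^n-1$ and $\prod_{j\in\delta^+(i)}(\omega x_i-x_j)$ for $i\in V$. The graph $G$ is called doubly covered if each pair of vertices connected by an arc is also connected by an arc in the opposite direction. (An undirected graph is viewed as the doubly covered directed graph having both arcs for each edge.) A cycle of length $k>2$ in $G$ is expressed as a sequence of arcs $C=\{(v_1,v_2),(v_2,v_3),\dots,(v_k,v_1)\}$ of $G$ with $v_1,\dots,v_k$ distinct. The cycle $C$ is called doubly covered if consecutive vertices in the cycle are connected by arcs of $G$ in both directions; otherwise $C$ is called directed. Cycle ideal: for a cycle $C$ of length $k$ with vertices $v_1,\dots,v_k$ in cyclic order and $\omega$ a primitive $k$-th root of unity (here $k=n$), $H_{G,C}=\langle g_1,\dots,g_k\rangle\subseteq\mathbb{K}[x_{v_1},\dots,x_{v_k}]$, where: - if $C$ is doubly covered, $g_i=x_{v_i}+\frac{\omega^{2+i}-\omega^{2-i}}{\omega^3-\omega}x_{v_{k-1}}+\frac{\omega^{1-i}-\omega^{3+i}}{\omega^3-\omega}x_{v_k}$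 for $1\le i\le k-2$, $g_{k-1}=(x_{v_{k-1}}-\omega x_{v_k})(x_{v_{k-1}}-\omega^{-1}x_{v_k})$, and $g_k=x_{v_k}^k-1$; - if $C$ is directed, $g_i=x_{v_{k-i}}-\omega^{k-i}x_{v_k}$ for $1\le i\le k-1$, and $g_k=x_{v_k}^k-1$. Uniquely Hamiltonian: a directed graph (resp. doubly covered graph) is called uniquely Hamiltonian if it contains $n$ cycles of length $n$ (resp. $2n$ cycles of length $n$). Here cycles are counted by the ways of writing them down: the $k$ cyclic shifts of a cycle of length $k$ are counted separately, and so are its reversals when every arc of the cycle is bidirectional, so a single cycle counts $k$ or $2k$ times.
   Formalization: Uniquely Hamiltonian counts 2n or n cycles by whether the Hamiltonian cycle, not the whole graph, is doubly covered; by the literal definition the claim fails for a 4-cycle with all arcs in both directions plus a one-way chord. *)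

theory Defs
  imports
    "Graph_Theory.Pair_Digraph"
    "Graph_Theory.Digraph_Component"
    "HOL-Library.Poly_Mapping"
    "HOL-Computational_Algebra.Polynomial"
begin

section \<open>Polynomials in several variables and their ideals\<close>

text \<open>
  \<open>('v, 'a) mpoly\<close> is the polynomial ring over \<open>'a\<close> with one variable for every element of \<open>'v\<close>:
  a monomial is a finitely supported exponent function, a polynomial a finitely supported
  coefficient function.
\<close>

type_synonym ('v, 'a) mpoly = "('v \<Rightarrow>\<^sub>0 nat) \<Rightarrow>\<^sub>0 'a"

definition var :: "'v \<Rightarrow> ('v, 'a::comm_ring_1) mpoly" where
  "var v = Poly_Mapping.single (Poly_Mapping.single v 1) 1"

definition const :: "'a \<Rightarrow> ('v, 'a::comm_ring_1) mpoly" where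
  "const c = Poly_Mapping.single 0 c"

text \<open>The ideal generated by a set is its span in the ring regarded as a module over itself.\<close>

definition ideal :: "'r::comm_ring_1 set \<Rightarrow> 'r set" where
  "ideal B = module.span (*) B"

lemma module_times: "module ((*) :: 'r::comm_ring_1 \<Rightarrow> 'r \<Rightarrow> 'r)"
  by unfold_locales (simp_all add: algebra_simps)

lemma ideal_eq: "ideal B = {\<Sum>b\<in>S. q b * b | S q. finite S \<and> S \<subseteq> B}"
  using module.span_explicit[OF module_times, of B] by (auto simp: ideal_def)

definition primitive_root_of_unity :: "nat \<Rightarrow> 'a::field \<Rightarrow> bool" where
  "primitive_root_of_unity n \<omega> \<longleftrightarrow> \<omega> ^ n = 1 \<and> (\<forall>m. 0 < m \<and> m < n \<longrightarrow> \<omega> ^ m \<noteq> 1)"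


section \<open>Hamiltonian cycles\<close>

text \<open>
  Cycles are those of the digraph library: lists of arcs
  \<open>[(v\<^sub>1, v\<^sub>2), (v\<^sub>2, v\<^sub>3), \<dots>, (v\<^sub>k, v\<^sub>1)]\<close> with \<open>v\<^sub>1, \<dots>, v\<^sub>k\<close> distinct. As they are lists, the cyclic
  shifts of a cycle are different cycles, and so is its reversal, when that is a cycle too.
\<close>

definition hamiltonian_cycles :: "'v pair_pre_digraph \<Rightarrow> ('v \<times> 'v) awalk set" where
  "hamiltonian_cycles G =
     {C. pre_digraph.cycle (with_proj G) C \<and> length C = card (pverts G)}"

definition doubly_covered_cycle :: "'v pair_pre_digraph \<Rightarrow> ('v \<times> 'v) awalk \<Rightarrow> bool" where
  "doubly_covered_cycle G C \<longleftrightarrow> (\<forall>(u, v) \<in> set C. (u, v) \<in> parcs G \<and> (v, u) \<in> parcs G)"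

text \<open>
  \<open>G\<close> has a single Hamiltonian cycle up to cyclic shifts and, if all of its arcs are bidirectional,
  reversal: the cycle accounts for \<open>n\<close> elements of \<open>hamiltonian_cycles G\<close> if it is directed
  and for \<open>2 * n\<close> if it is doubly covered. The case distinction is on the cycle, not on \<open>G\<close>: a
  Hamiltonian cycle with arcs in both directions also counts \<open>2 * n\<close> times if \<open>G\<close> has a
  one-way arc off that cycle.
\<close>

definition uniquely_hamiltonian :: "'v pair_pre_digraph \<Rightarrow> bool" where
  "uniquely_hamiltonian G \<longleftrightarrow>
     (\<exists>C \<in> hamiltonian_cycles G.
        card (hamiltonian_cycles G) =
          (if doubly_covered_cycle G C then 2 * card (pverts G) else card (pverts G)))"

lemma uniquely_hamiltonian_doubly_covered_graph:
  assumes "symmetric (with_proj G)" and "card (pverts G) > 0"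
  shows "uniquely_hamiltonian G \<longleftrightarrow> card (hamiltonian_cycles G) = 2 * card (pverts G)"
proof -
  have dc: "doubly_covered_cycle G C" if "C \<in> hamiltonian_cycles G" for C
    using that assms(1)
    by (auto simp: hamiltonian_cycles_def doubly_covered_cycle_def pre_digraph.cycle_def
        pre_digraph.awalk_def symmetric_def dest: symD)
  have "hamiltonian_cycles G \<noteq> {}"
    if "card (hamiltonian_cycles G) = 2 * card (pverts G)"
    using that assms(2) by (metis card.empty mult_is_0 not_gr0 zero_neq_numeral)
  with dc show ?thesis
    by (auto simp: uniquely_hamiltonian_def)
qed

lemma uniquely_hamiltonian_directed:
  assumes "\<And>C. C \<in> hamiltonian_cycles G \<Longrightarrow> \<not> doubly_covered_cycle G C"
    and "card (pverts G) > 0"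
  shows "uniquely_hamiltonian G \<longleftrightarrow> card (hamiltonian_cycles G) = card (pverts G)"
proof -
  have "hamiltonian_cycles G \<noteq> {}"
    if "card (hamiltonian_cycles G) = card (pverts G)"
    using that assms(2) by (metis card.empty less_irrefl)
  with assms(1) show ?thesis
    by (auto simp: uniquely_hamiltonian_def)
qed


section \<open>The two ideals\<close>

text \<open>
  The polynomial ring has a variable for every element of \<open>'v\<close>, so it is the intended one when
  \<open>pverts G = UNIV\<close> and, for \<open>cycle_ideal\<close>, when in addition \<open>C\<close> visits every vertex.
\<close>

definition hamiltonian_ideal ::
  "'a::field \<Rightarrow> 'v pair_pre_digraph \<Rightarrow> ('v, 'a) mpoly set" where
  "hamiltonian_ideal \<omega> G = ideal
     ({var i ^ card (pverts G) - 1 | i. i \<in> pverts G} \<union>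
      {\<Prod>j \<in> {j. (i, j) \<in> parcs G}. (const \<omega> * var i - var j) | i. i \<in> pverts G})"

text \<open>\<open>cycle_vertex C i\<close> is \<open>v\<^sub>i\<close>, with indices starting at 1.\<close>

definition cycle_vertex :: "('v \<times> 'v) awalk \<Rightarrow> nat \<Rightarrow> 'v" where
  "cycle_vertex C i = fst (C ! (i - 1))"

definition doubly_covered_cycle_generators ::
  "'a::field \<Rightarrow> ('v \<times> 'v) awalk \<Rightarrow> ('v, 'a) mpoly set" where
  "doubly_covered_cycle_generators \<omega> C =
     (let k = length C; x = (\<lambda>i. var (cycle_vertex C i)) in
      {x i
        + const ((\<omega> powi (2 + int i) - \<omega> powi (2 - int i)) / (\<omega> ^ 3 - \<omega>)) * x (k - 1)
        + const ((\<omega> powi (1 - int i) - \<omega> powi (3 + int i)) / (\<omega> ^ 3 - \<omega>)) * x k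
        | i. 1 \<le> i \<and> i \<le> k - 2} \<union>
      {(x (k - 1) - const \<omega> * x k) * (x (k - 1) - const (inverse \<omega>) * x k),
       x k ^ k - 1})"

definition directed_cycle_generators ::
  "'a::field \<Rightarrow> ('v \<times> 'v) awalk \<Rightarrow> ('v, 'a) mpoly set" where
  "directed_cycle_generators \<omega> C =
     (let k = length C; x = (\<lambda>i. var (cycle_vertex C i)) in
      {x (k - i) - const (\<omega> ^ (k - i)) * x k | i. 1 \<le> i \<and> i \<le> k - 1} \<union>
      {x k ^ k - 1})"

definition cycle_ideal ::
  "'a::field \<Rightarrow> 'v pair_pre_digraph \<Rightarrow> ('v \<times> 'v) awalk \<Rightarrow> ('v, 'a) mpoly set" where
  "cycle_ideal \<omega> G C = ideal
     (if doubly_covered_cycle G C then doubly_covered_cycle_generators \<omega> C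
      else directed_cycle_generators \<omega> C)"

end

theory Submission
  imports Defs
begin

text \<open>
  A zero of \<open>H\<^sub>G\<close> labels the vertices by \<open>n\<close>-th roots of unity so that every vertex has an
  out-neighbour whose label is \<open>\<omega>\<close> times its own. Following these arcs meets all \<open>n\<close> labels, so
  the labelling is a bijection and the arcs form a Hamiltonian cycle: the zeros correspond to the
  Hamiltonian cycles, written from the vertex with label 1. For a Hamiltonian cycle \<open>C\<close>, the
  zeros of \<open>H\<^bsub>G,C\<^esub>\<close> are \<open>v\<^sub>i \<mapsto> \<omega>\<^sup>i c\<close> with \<open>c\<^sup>n = 1\<close> and, if \<open>C\<close> is doubly covered,
  also \<open>v\<^sub>i \<mapsto> \<omega>\<^sup>-\<^sup>i c\<close>; there are \<open>n\<close> or \<open>2n\<close> of them, and they are zeros of \<open>H\<^sub>G\<close>.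
  Thus \<open>G\<close> is uniquely Hamiltonian via \<open>C\<close> iff the two zero sets agree. Both ideals contain
  every polynomial vanishing on their zeros, by repeated use of the Chinese remainder principle:
  if \<open>\<Prod>\<^bsub>a\<in>S\<^esub> (y - a) \<in> J\<close> for a finite set \<open>S\<close> of scalars, then \<open>J\<close> is the intersection of
  the ideals \<open>J + (y - a)\<close>. So equal zero sets mean equal ideals.
\<close>

section \<open>Ideals\<close>

lemmas ideal_0 = module.span_zero [OF module_times, folded ideal_def]
  and ideal_base = module.span_base [OF module_times, folded ideal_def]
  and ideal_add = module.span_add [OF module_times, folded ideal_def]
  and ideal_diff = module.span_diff [OF module_times, folded ideal_def]
  and ideal_mult = module.span_scale [OF module_times, folded ideal_def]
  and ideal_mono = module.span_mono [OF module_times, folded ideal_def]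
  and ideal_insert_iff = module.span_breakdown_eq [OF module_times, folded ideal_def]

lemma ideal_subset:
  assumes "B \<subseteq> ideal C"
  shows "ideal B \<subseteq> ideal C"
  using assms module.span_minimal [OF module_times, of B "ideal C"]
    module.subspace_span [OF module_times, of C]
  by (simp add: ideal_def)

lemma ideal_one: "1 \<in> ideal B \<Longrightarrow> f \<in> ideal B"
  using ideal_mult [of 1 B f] by simp

text \<open>The comaximal case of the Chinese remainder principle. Modulo \<open>ideal B\<close>,
  \<open>f\<close> equals both \<open>k * s\<close> and \<open>l * t\<close>, so
  \<open>f = b * t * f + a * s * f\<close> becomes a multiple of \<open>s * t\<close>.\<close>

lemma ideal_insert_mult:
  assumes s: "f \<in> ideal (insert s B)" and t: "f \<in> ideal (insert t B)"
    and comaximal: "a * s + b * t = 1"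
  shows "f \<in> ideal (insert (s * t) B)"
proof -
  obtain k where k: "f - k * s \<in> ideal B"
    using s ideal_insert_iff by blast
  obtain l where l: "f - l * t \<in> ideal B"
    using t ideal_insert_iff by blast
  have "f - (k * b + l * a) * (s * t) = (b * t) * (f - k * s) + (a * s) * (f - l * t)
          + f * (1 - (a * s + b * t))"
    by (simp add: algebra_simps)
  also have "\<dots> = (b * t) * (f - k * s) + (a * s) * (f - l * t)"
    by (simp add: comaximal)
  also have "\<dots> \<in> ideal B"
    using k l by (intro ideal_add ideal_mult)
  finally show ?thesis
    using ideal_insert_iff by blast
qed


section \<open>Evaluation of polynomials\<close>

lemma const_0 [simp]: "const 0 = 0"
  by (simp add: const_def)

lemma const_1 [simp]: "const 1 = 1"
  by (simp add: const_def)

lemma const_add: "const (a + b) = const a + const b"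
  by (simp add: const_def single_add)

lemma const_diff: "const (a - b) = const a - const b"
  by (simp add: const_def single_diff)

lemma const_mult: "const (a * b) = const a * const b"
  by (simp add: const_def mult_single)

lemma const_uminus: "const (- a) = - const a"
  by (simp add: const_def single_uminus)

text \<open>This serves on two levels: polynomials are sums of terms, and exponent functions are
  sums of powers of single variables.\<close>

lemma poly_mapping_add_induct [case_names single add]:
  fixes f :: "'k \<Rightarrow>\<^sub>0 'b::comm_monoid_add"
  assumes single: "\<And>k c. P (Poly_Mapping.single k c)"
    and add: "\<And>f g. P f \<Longrightarrow> P g \<Longrightarrow> P (f + g)"
  shows "P f"
proof (induction f rule: update_induct)
  case const
  then show ?case
    using single [of undefined 0] by simp
next
  case (update f k c)
  have "Poly_Mapping.update k c f = Poly_Mapping.single k c + f"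
    using update(1)
    by (intro poly_mapping_eqI)
      (auto simp: lookup_update lookup_add lookup_single not_in_keys_iff_lookup_eq_zero)
  then show ?case
    using add [OF single update(3)] by simp
qed

lemma mpoly_induct [case_names const var add mult]:
  fixes f :: "('v, 'a::comm_ring_1) mpoly"
  assumes const: "\<And>c. P (const c)" and var: "\<And>v. P (var v)"
    and add: "\<And>f g. P f \<Longrightarrow> P g \<Longrightarrow> P (f + g)"
    and mult: "\<And>f g. P f \<Longrightarrow> P g \<Longrightarrow> P (f * g)"
  shows "P f"
proof (induction f rule: poly_mapping_add_induct)
  case (single m c)
  have "P (Poly_Mapping.single m 1)"
  proof (induction m rule: poly_mapping_add_induct)
    case (single v k)
    show ?case
    proof (induction k)
      case 0
      then show ?case
        using const [of 1] by simp
    next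
      case (Suc k)
      have "Poly_Mapping.single (Poly_Mapping.single v (Suc k)) 1 =
          var v * Poly_Mapping.single (Poly_Mapping.single v k) (1 :: 'a)"
        by (simp add: var_def mult_single flip: single_add)
      then show ?case
        using mult [OF var Suc] by simp
    qed
  next
    case (add m1 m2)
    then show ?case
      using mult [OF add] by (simp add: mult_single)
  qed
  then show ?case
    using mult [OF const] by (metis const_def add_0 mult_1_right mult_single)
qed (rule add)

text \<open>Since \<open>'v\<close> is finite, a monomial is evaluated as a product over all
  variables; absent ones contribute the factor 1.\<close>

definition meval :: "('v::finite \<Rightarrow> 'a::comm_ring_1) \<Rightarrow> ('v, 'a) mpoly \<Rightarrow> 'a" where
  "meval p f = (\<Sum>m\<in>Poly_Mapping.keys f.
     Poly_Mapping.lookup f m * (\<Prod>v\<in>UNIV. p v ^ Poly_Mapping.lookup m v))"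

lemma meval_single:
  "meval p (Poly_Mapping.single m c) = c * (\<Prod>v\<in>UNIV. p v ^ Poly_Mapping.lookup m v)"
  by (simp add: meval_def)

lemma meval_const [simp]: "meval p (const c) = c"
  by (simp add: const_def meval_single)

lemma meval_0 [simp]: "meval p 0 = 0" and meval_1 [simp]: "meval p 1 = 1"
  using meval_const [of p 0] meval_const [of p 1] by simp_all

lemma meval_var [simp]: "meval p (var v) = p v"
proof -
  have "(\<Prod>u\<in>UNIV. p u ^ Poly_Mapping.lookup (Poly_Mapping.single v 1) u) =
      (\<Prod>u\<in>UNIV. if v = u then p u else 1)"
    by (intro prod.cong) (auto simp: lookup_single when_def)
  then show ?thesis
    by (simp add: var_def meval_single)
qed

lemma meval_add [simp]: "meval p (f + g) = meval p f + meval p g"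
  unfolding meval_def
  by (rule setsum_keys_plus_distrib) (simp_all add: distrib_right)

lemma meval_mult [simp]: "meval p (f * g) = meval p f * meval p g"
proof (induction f rule: poly_mapping_add_induct)
  case (single m c)
  show ?case
  proof (induction g rule: poly_mapping_add_induct)
    case (single l d)
    show ?case
      by (simp add: mult_single meval_single lookup_add power_add prod.distrib mult_ac)
  qed (simp add: distrib_left)
qed (simp add: distrib_right)

lemma meval_diff [simp]: "meval p (f - g) = meval p f - meval p g"
  using meval_add [of p "f - g" g] by (simp add: algebra_simps)

lemma meval_power [simp]: "meval p (f ^ k) = meval p f ^ k"
  by (induction k) simp_all

lemma meval_prod [simp]: "meval p (\<Prod>i\<in>A. f i) = (\<Prod>i\<in>A. meval p (f i))"
  by (induction A rule: infinite_finite_induct) simp_all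


section \<open>Ideals determined by a finite set of zeros\<close>

lemma meval_sum [simp]: "meval p (\<Sum>i\<in>A. f i) = (\<Sum>i\<in>A. meval p (f i))"
  by (induction A rule: infinite_finite_induct) simp_all

definition zeros :: "('v::finite, 'a::comm_ring_1) mpoly set \<Rightarrow> ('v \<Rightarrow> 'a) set" where
  "zeros B = {p. \<forall>g\<in>B. meval p g = 0}"

text \<open>The conclusion of the Nullstellensatz for a radical ideal. It reduces inclusions between
  ideals to reverse inclusions between zero sets.\<close>

definition zero_determined :: "('v::finite, 'a::comm_ring_1) mpoly set \<Rightarrow> bool" where
  "zero_determined B \<longleftrightarrow> (\<forall>f. (\<forall>p\<in>zeros B. meval p f = 0) \<longrightarrow> f \<in> ideal B)"

lemma meval_ideal:
  assumes "p \<in> zeros B" and "f \<in> ideal B"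
  shows "meval p f = 0"
  using assms by (auto simp: ideal_eq zeros_def subset_iff intro!: sum.neutral)

lemma zeros_eq_if_ideal_eq:
  assumes "ideal B = ideal C"
  shows "zeros B = zeros C"
  using assms meval_ideal ideal_base unfolding zeros_def by blast

lemma ideal_subset_if_zeros_subset:
  assumes "zero_determined C" and "zeros C \<subseteq> zeros B"
  shows "ideal B \<subseteq> ideal C"
  using assms by (intro ideal_subset) (auto simp: zero_determined_def zeros_def)

text \<open>The product is a polynomial expression in its first entry, and such expressions respect
  congruence modulo \<open>x - y\<close>. With \<open>y\<close> a constant this is the remainder
  theorem.\<close>

lemma dvd_prod_diff:
  fixes x y :: "'a::comm_ring_1"
  shows "x - y dvd (\<Prod>i\<in>S. x - f i) - (\<Prod>i\<in>S. y - f i)"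
proof (induction S rule: infinite_finite_induct)
  case (insert i S)
  have "(\<Prod>i\<in>insert i S. x - f i) - (\<Prod>i\<in>insert i S. y - f i) =
      (x - f i) * ((\<Prod>i\<in>S. x - f i) - (\<Prod>i\<in>S. y - f i)) + (x - y) * (\<Prod>i\<in>S. y - f i)"
    using insert by (simp add: algebra_simps)
  then show ?case
    using insert.IH by simp
qed simp_all

lemma const_prod: "const (\<Prod>i\<in>A. f i) = (\<Prod>i\<in>A. const (f i))"
  by (induction A rule: infinite_finite_induct) (simp_all add: const_mult)

text \<open>Induction on \<open>S\<close>: one more linear factor is merged with the product of the
  others by \<open>ideal_insert_mult\<close>.\<close>

lemma ideal_insert_prod:
  fixes f y :: "('v, 'a::field) mpoly"
  assumes "finite S" and "\<And>a. a \<in> S \<Longrightarrow> f \<in> ideal (insert (y - const a) B)"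
  shows "f \<in> ideal (insert (\<Prod>a\<in>S. y - const a) B)"
  using assms
proof (induction S)
  case empty
  then show ?case
    by (simp add: ideal_one ideal_base)
next
  case (insert b S)
  define P where "P = (\<Prod>a\<in>S. y - const a)"
  \<comment> \<open>The value of \<open>P\<close> at \<open>y = b\<close>. It is a non-zero scalar
    because \<open>b\<close> is not in \<open>S\<close>, which makes \<open>y - const b\<close> and
    \<open>P\<close> comaximal.\<close>
  define c where "c = (\<Prod>a\<in>S. b - a)"
  have "c \<noteq> 0"
    using insert.hyps by (auto simp: c_def)
  have "y - const b dvd P - const c"
    using dvd_prod_diff [of y "const b" const S] by (simp add: P_def c_def const_prod const_diff)
  then obtain q where q: "P - const c = (y - const b) * q"
    by (elim dvdE)
  have "(- const (inverse c) * q) * (y - const b) + const (inverse c) * P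
      = const (inverse c) * (P - (y - const b) * q)"
    by (simp add: algebra_simps)
  also have "\<dots> = const (inverse c * c)"
    unfolding const_mult q [symmetric] by simp
  finally have "(- const (inverse c) * q) * (y - const b) + const (inverse c) * P = 1"
    using \<open>c \<noteq> 0\<close> by simp
  moreover have "f \<in> ideal (insert (y - const b) B)" "f \<in> ideal (insert P B)"
    using insert.IH insert.prems by (simp_all add: P_def)
  ultimately have "f \<in> ideal (insert ((y - const b) * P) B)"
    by (blast intro: ideal_insert_mult)
  then show ?case
    using insert.hyps by (simp add: P_def)
qed

section \<open>Splitting an ideal along finitely many values\<close>

lemma ideal_insert_absorb:
  assumes "s \<in> ideal B"
  shows "ideal (insert s B) = ideal B"
proof
  show "ideal (insert s B) \<subseteq> ideal B"
    using assms ideal_base by (intro ideal_subset) blast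
  show "ideal B \<subseteq> ideal (insert s B)"
    by (rule ideal_mono) blast
qed

text \<open>Adjoining \<open>y - const a\<close> cuts the zero set down to the points where
  \<open>y\<close> has the value \<open>a\<close>. A polynomial vanishing on all zeros thus lies in
  every enlarged ideal, hence in the ideal with the product adjoined, which is
  \<open>ideal B\<close> itself.\<close>

lemma zero_determined_split:
  fixes B :: "('v::finite, 'a::field) mpoly set"
  assumes "finite S" and "(\<Prod>a\<in>S. y - const a) \<in> ideal B"
    and "\<And>a. a \<in> S \<Longrightarrow> zero_determined (insert (y - const a) B)"
  shows "zero_determined B"
  unfolding zero_determined_def
proof (intro allI impI)
  fix f
  assume "\<forall>p\<in>zeros B. meval p f = 0"
  then have "f \<in> ideal (insert (y - const a) B)" if "a \<in> S" for a
    using assms(3) [OF that] by (auto simp: zero_determined_def zeros_def)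
  then show "f \<in> ideal B"
    using ideal_insert_prod [OF assms(1)] ideal_insert_absorb [OF assms(2)] by blast
qed

text \<open>Congruence to the value at \<open>p\<close> passes from the variables through sums and
  products.\<close>

lemma diff_const_meval_mem_ideal:
  assumes "\<And>v. var v - const (p v) \<in> ideal B"
  shows "f - const (meval p f) \<in> ideal B"
proof (induction f rule: mpoly_induct)
  case (const c)
  then show ?case
    by (simp add: ideal_0)
next
  case (var v)
  then show ?case
    using assms by simp
next
  case (add f g)
  then show ?case
    using ideal_add [OF add] by (simp add: const_add algebra_simps)
next
  case (mult f g)
  have "f * g - const (meval p (f * g)) =
      f * (g - const (meval p g)) + const (meval p g) * (f - const (meval p f))"
    by (simp add: const_mult algebra_simps)
  then show ?case
    using mult by (simp add: ideal_add ideal_mult)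
qed

text \<open>Modulo the ideal every polynomial is a scalar, its value at \<open>p\<close>. If
  \<open>p\<close> is a zero, a polynomial vanishing there is congruent to 0; otherwise some
  generator is congruent to a non-zero scalar, and the ideal is the whole ring.\<close>

lemma zero_determined_point:
  fixes B :: "('v::finite, 'a::field) mpoly set"
  assumes "\<And>v. \<exists>c. var v - const c \<in> ideal B"
  shows "zero_determined B"
  unfolding zero_determined_def
proof (intro allI impI)
  fix f
  assume *: "\<forall>p\<in>zeros B. meval p f = 0"
  obtain p where p: "\<And>v. var v - const (p v) \<in> ideal B"
    using assms by metis
  show "f \<in> ideal B"
  proof (cases "p \<in> zeros B")
    case True
    then show ?thesis
      using * diff_const_meval_mem_ideal [OF p, of f] by simp
  next
    case False
    then obtain g where g: "g \<in> B" "meval p g \<noteq> 0"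
      by (auto simp: zeros_def)
    have "g - (g - const (meval p g)) \<in> ideal B"
      by (intro ideal_diff ideal_base g diff_const_meval_mem_ideal p)
    then have "const (inverse (meval p g)) * const (meval p g) \<in> ideal B"
      by (simp add: ideal_mult)
    then show ?thesis
      using g by (simp add: ideal_one flip: const_mult)
  qed
qed

text \<open>The variables are fixed one after another by \<open>zero_determined_split\<close> until
  \<open>zero_determined_point\<close> applies.\<close>

lemma zero_determined_grid:
  fixes B :: "('v::finite, 'a::field) mpoly set"
  assumes "finite S" and "\<And>v. (\<Prod>a\<in>S. var v - const a) \<in> ideal B"
  shows "zero_determined B"
proof -
  \<comment> \<open>\<open>W\<close> contains the variables not yet fixed. The generating set grows
    as variables are fixed, so the claim is made for all \<open>B\<close>.\<close>
  have "zero_determined B"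
    if "\<And>v. (\<Prod>a\<in>S. var v - const a) \<in> ideal B"
      and "\<And>v. v \<notin> W \<Longrightarrow> \<exists>c. var v - const c \<in> ideal B"
    for W and B :: "('v, 'a) mpoly set"
    using finite [of W] that
  proof (induction W arbitrary: B)
    case empty
    then show ?case
      by (intro zero_determined_point) blast
  next
    case (insert w W)
    have "zero_determined (insert (var w - const a) B)" for a
    proof (rule insert.IH)
      have sub: "ideal B \<subseteq> ideal (insert (var w - const a) B)"
        by (rule ideal_mono) blast
      show "(\<Prod>a\<in>S. var v - const a) \<in> ideal (insert (var w - const a) B)" for v
        using insert.prems sub by blast
      show "\<exists>c. var v - const c \<in> ideal (insert (var w - const a) B)" if "v \<notin> W" for v
      proof (cases "v = w")
        case True
        have "var v - const a \<in> ideal (insert (var w - const a) B)"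
          by (rule ideal_base) (simp add: True)
        then show ?thesis ..
      next
        case False
        then show ?thesis
          using insert.prems(2) [of v] that sub by auto
      qed
    qed
    with insert.prems(1) show ?case
      by (rule zero_determined_split [OF assms(1)])
  qed
  from this [of B UNIV] show ?thesis
    using assms by simp
qed


section \<open>Roots of unity\<close>

text \<open>\<open>poly (map_poly const p) y\<close> substitutes the multivariate \<open>y\<close>
  into the univariate \<open>p\<close>. Additivity and multiplicativity of this substitution
  transport univariate identities.\<close>

lemma poly_map_poly_const_add:
  fixes y :: "('v, 'a::comm_ring_1) mpoly"
  shows "poly (map_poly const (p + q)) y = poly (map_poly const p) y + poly (map_poly const q) y"
proof -
  have "map_poly const (p + q) = (map_poly const p + map_poly const q :: ('v, 'a) mpoly poly)"
    by (intro poly_eqI) (simp add: coeff_map_poly const_add)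
  then show ?thesis
    by simp
qed

lemma poly_map_poly_const_mult:
  "poly (map_poly const (p * q)) y = poly (map_poly const p) y * poly (map_poly const q) y"
proof (induction p)
  case (pCons a p)
  then show ?case
    by (simp add: poly_map_poly_const_add map_poly_smult map_poly_pCons const_mult algebra_simps)
qed simp

lemma power_power_commute: "((x::'a::monoid_mult) ^ i) ^ j = (x ^ j) ^ i"
  by (metis mult.commute power_mult)

lemma primitive_root_inj_on:
  assumes "primitive_root_of_unity n \<omega>"
  shows "inj_on (\<lambda>i. \<omega> ^ i) {..<n}"
proof (rule linorder_inj_onI)
  fix i j
  assume "i < j" and "j \<in> {..<n}"
  then have "\<omega> ^ n = 1" "\<omega> ^ (j - i) \<noteq> 1" "n > 0"
    using assms by (auto simp: primitive_root_of_unity_def)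
  then have "\<omega> \<noteq> 0"
    by (auto simp: zero_power)
  moreover have "\<omega> ^ j = \<omega> ^ i * \<omega> ^ (j - i)"
    using \<open>i < j\<close> by (simp flip: power_add)
  ultimately show "\<omega> ^ i \<noteq> \<omega> ^ j"
    using \<open>\<omega> ^ (j - i) \<noteq> 1\<close> by auto
qed auto

lemma degree_monom_diff_1: "n > 0 \<Longrightarrow> degree (monom 1 n - 1 :: 'a::field poly) = n"
  by (subst diff_conv_add_uminus, subst degree_add_eq_left)
    (simp_all add: degree_monom_eq)

text \<open>The powers of \<omega> already provide \<open>n\<close> distinct roots of
  \<open>monom 1 n - 1\<close>, and a polynomial of degree \<open>n\<close> has no more.\<close>

lemma roots_of_unity_eq:
  fixes \<omega> :: "'a::field"
  assumes "primitive_root_of_unity n \<omega>" and "n > 0"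
  shows "{z. z ^ n = 1} = (\<lambda>i. \<omega> ^ i) ` {..<n}" and "finite {z::'a. z ^ n = 1}"
    and "card {z::'a. z ^ n = 1} = n"
proof -
  define P where "P = (monom 1 n - 1 :: 'a poly)"
  have P: "degree P = n"
    using assms(2) by (simp add: P_def degree_monom_diff_1)
  then have "P \<noteq> 0"
    using assms(2) by auto
  have roots: "{z. z ^ n = 1} = {z. poly P z = 0}"
    by (simp add: P_def poly_monom)
  show fin: "finite {z::'a. z ^ n = 1}"
    unfolding roots using \<open>P \<noteq> 0\<close> by (rule poly_roots_finite)
  have le: "card {z::'a. z ^ n = 1} \<le> n"
    unfolding roots using card_poly_roots_bound [OF \<open>P \<noteq> 0\<close>] P by simp
  have sub: "(\<lambda>i. \<omega> ^ i) ` {..<n} \<subseteq> {z. z ^ n = 1}"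
    using assms(1)
    by (auto simp: primitive_root_of_unity_def power_power_commute [of _ _ n])
  have card: "card ((\<lambda>i. \<omega> ^ i) ` {..<n}) = n"
    using primitive_root_inj_on [OF assms(1)] by (simp add: card_image)
  show "{z. z ^ n = 1} = (\<lambda>i. \<omega> ^ i) ` {..<n}"
    using card_seteq [OF fin sub] le card by simp
  then show "card {z::'a. z ^ n = 1} = n"
    using card by simp
qed

text \<open>For univariate polynomials both sides are monic of degree \<open>n\<close> and vanish at
  the same \<open>n\<close> points, so they agree; then \<open>y\<close> is substituted.\<close>

lemma prod_roots_of_unity:
  fixes \<omega> :: "'a::field" and y :: "('v, 'a) mpoly"
  assumes "primitive_root_of_unity n \<omega>" and "n > 0"
  shows "(\<Prod>a | a ^ n = 1. y - const a) = y ^ n - 1"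
proof -
  define R where "R = {a::'a. a ^ n = 1}"
  have R: "finite R" "card R = n"
    using roots_of_unity_eq [OF assms] by (simp_all add: R_def)
  define Q where "Q = (\<Prod>a\<in>R. [:- a, 1:])"
  have deg: "degree Q = n"
    unfolding Q_def using R by (subst degree_prod_eq_sum_degree) simp_all
  have "lead_coeff Q = 1"
    unfolding Q_def by (simp add: lead_coeff_prod)
  have eq: "Q = monom 1 n - 1"
  proof (rule poly_eqI_degree_lead_coeff)
    show "poly.coeff Q n = poly.coeff (monom 1 n - 1) n"
      using \<open>lead_coeff Q = 1\<close> deg assms(2) by simp
    show "poly Q z = poly (monom 1 n - 1) z" if "z \<in> R" for z
    proof -
      have "poly Q z = 0"
        using R that by (simp add: Q_def poly_prod)
      then show ?thesis
        using that by (simp add: R_def poly_monom)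
    qed
  qed (use R deg assms(2) in \<open>simp_all add: degree_monom_diff_1\<close>)
  have "poly (map_poly const Q) y = (\<Prod>a\<in>R. poly (map_poly const [:- a, 1:]) y)"
    unfolding Q_def
    by (induction R rule: infinite_finite_induct)
      (simp_all add: poly_map_poly_const_mult map_poly_1 del: mult_pCons_left)
  also have "\<dots> = (\<Prod>a\<in>R. y - const a)"
    by (simp add: map_poly_pCons const_uminus)
  \<comment> \<open>Adding 1 turns \<open>Q\<close> into a monomial, so additivity of the
    substitution is enough.\<close>
  finally have "(\<Prod>a\<in>R. y - const a) + 1 = poly (map_poly const (Q + 1)) y"
    by (simp add: poly_map_poly_const_add map_poly_1)
  also have "\<dots> = y ^ n"
    by (simp add: eq map_poly_monom poly_monom)
  finally show ?thesis
    unfolding R_def by (simp add: eq_diff_eq)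
qed


section \<open>Hamiltonian cycles and zeros of the Hamiltonian ideal\<close>

lemma pcas_iff: "pcas u p w \<longleftrightarrow> u # map snd p = map fst p @ [w]"
  by (induction p arbitrary: u) auto

lemma pawalk_verts_eq: "pcas u p w \<Longrightarrow> pawalk_verts u p = u # map snd p"
  by (induction p arbitrary: u) auto

locale labelled_graph =
  fixes G :: "'v::finite pair_pre_digraph" and \<omega> :: "'a::field" and n :: nat
  assumes pverts: "pverts G = UNIV"
    and n_eq: "n = card (UNIV :: 'v set)"
    and n_ge_3: "n \<ge> 3"
    and prim: "primitive_root_of_unity n \<omega>"
begin

lemma n_pos: "n > 0"
  using n_ge_3 by simp

lemma omega_power_n: "\<omega> ^ n = 1"
  using prim by (simp add: primitive_root_of_unity_def)

lemma omega_power_power: "(\<omega> ^ i) ^ n = 1"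
  by (simp add: power_power_commute [of _ _ n] omega_power_n)

lemma omega_nonzero: "\<omega> \<noteq> 0"
  using omega_power_n n_pos by (auto simp: zero_power)

lemma omega_power_mod: "\<omega> ^ (i mod n) = \<omega> ^ i"
proof -
  have "\<omega> ^ i = \<omega> ^ (n * (i div n) + i mod n)"
    by simp
  also have "\<dots> = \<omega> ^ (i mod n)"
    unfolding power_add power_mult omega_power_n by simp
  finally show ?thesis ..
qed

text \<open>The rotation encodes the closed walk: each head is the next tail, and the last head is
  the first tail. It also lets distinctness pass between heads and tails.\<close>

lemma hamiltonian_cycles_iff:
  "C \<in> hamiltonian_cycles G \<longleftrightarrow> length C = n \<and> set C \<subseteq> parcs G \<and>
     distinct (map fst C) \<and> map snd C = rotate1 (map fst C)"
proof -
  have "pre_digraph.cycle (with_proj G) C \<longleftrightarrow>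
      set C \<subseteq> parcs G \<and> distinct (map fst C) \<and> map snd C = rotate1 (map fst C)"
    if "C \<noteq> []"
  proof -
    have "pre_digraph.cycle (with_proj G) C \<longleftrightarrow>
        (\<exists>u. set C \<subseteq> parcs G \<and> u # map snd C = map fst C @ [u] \<and> distinct (map snd C))"
      using that
      by (auto simp: pre_digraph.cycle_def pre_digraph.awalk_def pverts
          cas_with_proj_eq awalk_verts_with_proj_eq pawalk_verts_eq
          simp flip: pcas_iff)
    also have "\<dots> \<longleftrightarrow>
        set C \<subseteq> parcs G \<and> distinct (map snd C) \<and> map snd C = rotate1 (map fst C)"
      using that by (cases C) auto
    also have "\<dots> \<longleftrightarrow>
        set C \<subseteq> parcs G \<and> distinct (map fst C) \<and> map snd C = rotate1 (map fst C)"
      by (metis distinct1_rotate)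
    finally show ?thesis .
  qed
  moreover have "card (pverts G) = n" "n > 0"
    using n_eq n_pos by (simp_all add: pverts)
  ultimately show ?thesis
    by (cases "C = []") (auto simp: hamiltonian_cycles_def)
qed

lemma snd_hamiltonian_cycle:
  assumes "C \<in> hamiltonian_cycles G" and "i < n"
  shows "snd (C ! i) = fst (C ! (Suc i mod n))"
proof -
  have len: "length C = n" and rot: "map snd C = rotate1 (map fst C)"
    using assms(1) by (simp_all add: hamiltonian_cycles_iff)
  have "snd (C ! i) = map snd C ! i"
    using assms(2) len by simp
  also have "\<dots> = fst (C ! (Suc i mod n))"
    using assms(2) len n_pos unfolding rot by (simp add: nth_rotate1)
  finally show ?thesis .
qed

lemma bij_betw_hamiltonian_cycle:
  assumes "C \<in> hamiltonian_cycles G"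
  shows "bij_betw (\<lambda>i. fst (C ! i)) {..<n} UNIV"
proof -
  have "inj_on (\<lambda>i. fst (C ! i)) {..<n}"
    using assms by (auto simp: hamiltonian_cycles_iff inj_on_def distinct_conv_nth)
  then show ?thesis
    using n_eq by (simp add: bij_betw_def card_image card_subset_eq)
qed

section \<open>The Hamiltonian ideal and its zeros\<close>

definition hamiltonian_generators :: "('v, 'a) mpoly set" where
  "hamiltonian_generators =
     {var i ^ n - 1 | i. True} \<union>
     {\<Prod>j \<in> {j. (i, j) \<in> parcs G}. (const \<omega> * var i - var j) | i. True}"

lemma hamiltonian_ideal_eq: "hamiltonian_ideal \<omega> G = ideal hamiltonian_generators"
  by (simp add: hamiltonian_ideal_def hamiltonian_generators_def pverts flip: n_eq)

text \<open>The generators \<open>var v ^ n - 1\<close> split into distinct linear factors, one for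
  each root of unity.\<close>

lemma zero_determined_hamiltonian_generators: "zero_determined hamiltonian_generators"
proof (rule zero_determined_grid)
  show "finite {a::'a. a ^ n = 1}"
    using roots_of_unity_eq [OF prim n_pos] by simp
  show "(\<Prod>a | a ^ n = 1. var v - const a) \<in> ideal hamiltonian_generators" for v
    unfolding prod_roots_of_unity [OF prim n_pos]
    by (rule ideal_base) (auto simp: hamiltonian_generators_def)
qed

text \<open>A product over a field vanishes only through a factor. A vertex without out-neighbours
  gives the empty product 1 and so excludes every zero.\<close>

lemma zeros_hamiltonian_generators:
  "p \<in> zeros hamiltonian_generators \<longleftrightarrow>
     (\<forall>i. p i ^ n = 1) \<and> (\<forall>i. \<exists>j. (i, j) \<in> parcs G \<and> p j = \<omega> * p i)"
proof -
  have "(\<Prod>j\<in>{j. (i, j) \<in> parcs G}. \<omega> * p i - p j) = 0 \<longleftrightarrow>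
      (\<exists>j. (i, j) \<in> parcs G \<and> p j = \<omega> * p i)" for i
    by (subst prod_zero_iff) auto
  moreover have "p \<in> zeros hamiltonian_generators \<longleftrightarrow> (\<forall>i. meval p (var i ^ n - 1) = 0) \<and>
      (\<forall>i. meval p (\<Prod>j\<in>{j. (i, j) \<in> parcs G}. const \<omega> * var i - var j) = 0)"
    unfolding zeros_def hamiltonian_generators_def by blast
  ultimately show ?thesis
    by simp
qed

section \<open>Zeros as bijective labellings, and their cycles\<close>

lemma bij_betw_zero:
  assumes "p \<in> zeros hamiltonian_generators"
  shows "bij_betw p UNIV {z. z ^ n = 1}"
proof -
  note p = assms [unfolded zeros_hamiltonian_generators]
  obtain v :: 'v where True
    by blast
  \<comment> \<open>Every label has \<omega> times itself among the labels, so the whole orbit of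
    \<open>p v\<close> under \<omega> occurs; this orbit consists of all roots of unity.\<close>
  have orbit: "\<omega> ^ k * p v \<in> range p" for k
  proof (induction k)
    case (Suc k)
    then obtain u where "p u = \<omega> ^ k * p v"
      by force
    then obtain j where "p j = \<omega> * (\<omega> ^ k * p v)"
      using p by metis
    then show ?case
      by (metis mult.assoc power_Suc rangeI)
  qed simp
  have "p v \<noteq> 0"
    using p n_pos by (metis power_0_left neq0_conv zero_neq_one)
  have "{z. z ^ n = 1} \<subseteq> range p"
  proof
    fix z :: 'a
    assume "z \<in> {z. z ^ n = 1}"
    then have "z / p v \<in> {z. z ^ n = 1}"
      using p by (simp add: power_divide)
    then obtain k where "z / p v = \<omega> ^ k"
      unfolding roots_of_unity_eq(1) [OF prim n_pos] by auto
    then show "z \<in> range p"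
      using orbit [of k] \<open>p v \<noteq> 0\<close> by (simp add: field_simps)
  qed
  then have "range p = {z. z ^ n = 1}"
    using p by auto
  moreover from this have "inj p"
    using roots_of_unity_eq(3) [OF prim n_pos] n_eq by (intro eq_card_imp_inj_on) simp_all
  ultimately show ?thesis
    by (simp add: bij_betw_def)
qed

text \<open>Starting at the label 1 singles out one cyclic shift; the other shifts come from the
  multiples of \<open>p\<close> by roots of unity. The last arc closes the cycle because
  \<open>\<omega> ^ n = 1\<close>.\<close>

definition cycle_of_zero :: "('v \<Rightarrow> 'a) \<Rightarrow> ('v \<times> 'v) list" where
  "cycle_of_zero p = map (\<lambda>i. (inv p (\<omega> ^ i), inv p (\<omega> ^ Suc i))) [0..<n]"

lemma cycle_of_zero_mem:
  assumes "p \<in> zeros hamiltonian_generators"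
  shows "cycle_of_zero p \<in> hamiltonian_cycles G"
proof -
  note p = assms [unfolded zeros_hamiltonian_generators]
  have inj: "inj p" and range: "range p = {z. z ^ n = 1}"
    using bij_betw_zero [OF assms] by (simp_all add: bij_betw_def)
  have root: "\<omega> ^ i \<in> range p" for i
    by (simp add: range omega_power_power)
  have arc: "(inv p (\<omega> ^ i), inv p (\<omega> ^ Suc i)) \<in> parcs G" for i
  proof -
    \<comment> \<open>The out-neighbour supplied by the zero condition carries the label
      \<open>\<omega> ^ Suc i\<close>, and injectivity of \<open>p\<close> identifies it.\<close>
    obtain j where j: "(inv p (\<omega> ^ i), j) \<in> parcs G" "p j = \<omega> * p (inv p (\<omega> ^ i))"
      using p by blast
    then have "p j = \<omega> ^ Suc i"
      using root [of i] by (simp add: f_inv_into_f)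
    then have "j = inv p (\<omega> ^ Suc i)"
      using inj by (metis inv_f_f)
    with j show ?thesis
      by simp
  qed
  have "inj_on (\<lambda>i. inv p (\<omega> ^ i)) {0..<n}"
  proof (rule inj_onI)
    fix i j
    assume "i \<in> {0..<n}" "j \<in> {0..<n}" "inv p (\<omega> ^ i) = inv p (\<omega> ^ j)"
    then show "i = j"
      using root primitive_root_inj_on [OF prim] by (metis atLeast0LessThan f_inv_into_f inj_onD)
  qed
  then have "distinct (map fst (cycle_of_zero p))"
    by (simp add: cycle_of_zero_def comp_def distinct_map)
  moreover have "map snd (cycle_of_zero p) = rotate1 (map fst (cycle_of_zero p))"
    by (intro nth_equalityI)
      (simp_all add: cycle_of_zero_def nth_rotate1 omega_power_mod del: power_Suc)
  ultimately show ?thesis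
    using arc by (auto simp: hamiltonian_cycles_iff cycle_of_zero_def)
qed

text \<open>A zero can be read off from its cycle: the vertex labelled \<open>\<omega> ^ i\<close>
  is the tail of the arc at position \<open>i\<close>, counted from 0.\<close>

lemma bij_betw_cycle_of_zero:
  "bij_betw cycle_of_zero (zeros hamiltonian_generators) (hamiltonian_cycles G)"
proof (rule bij_betw_imageI)
  show "inj_on cycle_of_zero (zeros hamiltonian_generators)"
  proof (intro inj_onI ext)
    fix p q v
    assume p: "p \<in> zeros hamiltonian_generators" and q: "q \<in> zeros hamiltonian_generators"
      and eq: "cycle_of_zero p = cycle_of_zero q"
    have "p v ^ n = 1"
      using p by (simp add: zeros_hamiltonian_generators)
    then obtain i where i: "i < n" "p v = \<omega> ^ i"
      using roots_of_unity_eq(1) [OF prim n_pos] by auto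
    then have "v = inv p (\<omega> ^ i)"
      using bij_betw_zero [OF p] by (metis bij_betw_def inv_f_f)
    also have "\<dots> = inv q (\<omega> ^ i)"
      using eq i(1) by (simp add: cycle_of_zero_def)
    finally have "q v = q (inv q (\<omega> ^ i))"
      by simp
    also have "\<dots> = p v"
      using bij_betw_zero [OF q] \<open>p v ^ n = 1\<close> i(2) by (simp add: bij_betw_def f_inv_into_f)
    finally show "p v = q v" ..
  qed
  show "cycle_of_zero ` zeros hamiltonian_generators = hamiltonian_cycles G"
  proof
    show "cycle_of_zero ` zeros hamiltonian_generators \<subseteq> hamiltonian_cycles G"
      using cycle_of_zero_mem by blast
    show "hamiltonian_cycles G \<subseteq> cycle_of_zero ` zeros hamiltonian_generators"
    proof
      fix C
      assume C: "C \<in> hamiltonian_cycles G"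
      then have arcs: "set C \<subseteq> parcs G" and len: "length C = n"
        by (simp_all add: hamiltonian_cycles_iff)
      define w where "w i = fst (C ! i)" for i
      have w: "bij_betw w {..<n} UNIV"
        using bij_betw_hamiltonian_cycle [OF C] by (simp add: w_def [abs_def])
      have nth: "C ! i = (w i, w (Suc i mod n))" if "i < n" for i
        using snd_hamiltonian_cycle [OF C that] by (simp add: w_def prod_eq_iff)
      \<comment> \<open>The preimage of \<open>C\<close> labels its vertex at position
        \<open>i\<close>, counted from 0, by \<open>\<omega> ^ i\<close>.\<close>
      define p where "p v = \<omega> ^ inv_into {..<n} w v" for v
      have p_w: "p (w i) = \<omega> ^ i" if "i < n" for i
        using that w by (simp add: p_def bij_betw_def inv_into_f_f)
      have p_zero: "p \<in> zeros hamiltonian_generators"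
        unfolding zeros_hamiltonian_generators
      proof (intro conjI allI)
        fix v
        obtain i where i: "i < n" "v = w i"
          using w by (metis UNIV_I bij_betw_def imageE lessThan_iff)
        show "p v ^ n = 1"
          using i roots_of_unity_eq(1) [OF prim n_pos] by (auto simp: p_w)
        have "(v, w (Suc i mod n)) \<in> parcs G"
          using arcs nth [of i] i len by (metis nth_mem subsetD)
        moreover have "p (w (Suc i mod n)) = \<omega> * p v"
          using i n_pos by (simp add: p_w omega_power_mod)
        ultimately show "\<exists>j. (v, j) \<in> parcs G \<and> p j = \<omega> * p v"
          by blast
      qed
      have inv_p: "inv p (\<omega> ^ i) = w (i mod n)" for i
        using bij_betw_zero [OF p_zero] n_pos
        by (intro inv_f_eq) (simp_all add: bij_betw_def p_w omega_power_mod)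
      have "cycle_of_zero p = C"
        using len nth
        by (intro nth_equalityI) (simp_all add: cycle_of_zero_def inv_p del: power_Suc)
      then show "C \<in> cycle_of_zero ` zeros hamiltonian_generators"
        using p_zero by blast
    qed
  qed
qed


section \<open>Zeros of the cycle ideals\<close>

definition cycle_generators :: "('v \<times> 'v) list \<Rightarrow> ('v, 'a) mpoly set" where
  "cycle_generators C =
     (if doubly_covered_cycle G C then doubly_covered_cycle_generators \<omega> C
      else directed_cycle_generators \<omega> C)"

lemma cycle_ideal_eq: "cycle_ideal \<omega> G C = ideal (cycle_generators C)"
  by (simp add: cycle_ideal_def cycle_generators_def)

section \<open>Positions and labellings along a Hamiltonian cycle\<close>

lemma bij_betw_cycle_vertex:
  assumes "C \<in> hamiltonian_cycles G"
  shows "bij_betw (cycle_vertex C) {1..n} UNIV"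
proof -
  have "bij_betw (\<lambda>i. i - 1) {1..n} {..<n}"
    by (rule bij_betw_byWitness [where f' = Suc]) auto
  from bij_betw_trans [OF this bij_betw_hamiltonian_cycle [OF assms]] show ?thesis
    by (simp add: cycle_vertex_def [abs_def] comp_def)
qed

lemma cycle_vertex_cases:
  assumes "C \<in> hamiltonian_cycles G"
  obtains i where "1 \<le> i" "i \<le> n" "v = cycle_vertex C i"
proof -
  have "v \<in> cycle_vertex C ` {1..n}"
    using bij_betw_cycle_vertex [OF assms] by (simp add: bij_betw_def)
  then show ?thesis
    using that by auto
qed

lemma cycle_vertex_arc:
  assumes "C \<in> hamiltonian_cycles G" and "1 \<le> i" and "i \<le> n"
  shows "(cycle_vertex C i, cycle_vertex C (Suc (i mod n))) \<in> set C"
proof -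
  have "C ! (i - 1) = (cycle_vertex C i, cycle_vertex C (Suc (i mod n)))"
    using snd_hamiltonian_cycle [OF assms(1), of "i - 1"] assms(2,3)
    by (simp add: cycle_vertex_def prod_eq_iff)
  moreover have "C ! (i - 1) \<in> set C"
    using assms by (intro nth_mem) (auto simp: hamiltonian_cycles_iff)
  ultimately show ?thesis
    by simp
qed

text \<open>Used with \<epsilon> equal to \<omega> or to its inverse, one for each orientation.
  Positions start at 1, so for \<open>\<epsilon> ^ n = 1\<close> the scalar \<open>c\<close> is the
  label of the last vertex.\<close>

definition labelling :: "('v \<times> 'v) list \<Rightarrow> 'a \<Rightarrow> 'a \<Rightarrow> 'v \<Rightarrow> 'a" where
  "labelling C \<epsilon> c v = \<epsilon> ^ inv_into {1..n} (cycle_vertex C) v * c"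

lemma labelling_cycle_vertex:
  assumes "C \<in> hamiltonian_cycles G" and "1 \<le> i" and "i \<le> n"
  shows "labelling C \<epsilon> c (cycle_vertex C i) = \<epsilon> ^ i * c"
  using bij_betw_cycle_vertex [OF assms(1)] assms(2,3)
  by (simp add: labelling_def bij_betw_def inv_into_f_f)

lemma labelling_eqI:
  assumes "C \<in> hamiltonian_cycles G"
    and "\<And>i. 1 \<le> i \<Longrightarrow> i \<le> n \<Longrightarrow> p (cycle_vertex C i) = \<epsilon> ^ i * c"
  shows "p = labelling C \<epsilon> c"
proof
  fix v
  obtain i where "1 \<le> i" "i \<le> n" "v = cycle_vertex C i"
    by (rule cycle_vertex_cases [OF assms(1)])
  then show "p v = labelling C \<epsilon> c v"
    using assms by (simp add: labelling_cycle_vertex)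
qed

lemma inj_labelling:
  assumes "C \<in> hamiltonian_cycles G" and "\<epsilon> ^ n = 1"
  shows "inj (labelling C \<epsilon>)"
proof (rule injI)
  fix c d
  assume "labelling C \<epsilon> c = labelling C \<epsilon> d"
  then have "labelling C \<epsilon> c (cycle_vertex C n) = labelling C \<epsilon> d (cycle_vertex C n)"
    by simp
  then show "c = d"
    using n_pos assms by (simp add: labelling_cycle_vertex)
qed

lemma inverse_omega_power_n: "inverse \<omega> ^ n = 1"
  by (simp add: power_inverse omega_power_n)

text \<open>The bound \<open>n \<ge> 3\<close> gives this. It keeps the two orientations apart and
  the denominator \<open>\<omega> ^ 3 - \<omega>\<close> non-zero.\<close>

lemma omega_power_2: "\<omega>\<^sup>2 \<noteq> 1"
  using prim n_ge_3 by (simp add: primitive_root_of_unity_def)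

lemma omega_neq_inverse: "\<omega> \<noteq> inverse \<omega>"
  using omega_power_2 omega_nonzero by (auto simp: power2_eq_square field_simps)

lemma omega_power_3_diff: "\<omega> ^ 3 - \<omega> \<noteq> 0"
  using omega_power_2 omega_nonzero by (simp add: power3_eq_cube power2_eq_square)

lemma zeros_directed_cycle_generators:
  assumes C: "C \<in> hamiltonian_cycles G"
  shows "zeros (directed_cycle_generators \<omega> C) = labelling C \<omega> ` {c. c ^ n = 1}"
proof -
  have len: "length C = n"
    using C by (simp add: hamiltonian_cycles_iff)
  have "p \<in> zeros (directed_cycle_generators \<omega> C) \<longleftrightarrow> p \<in> labelling C \<omega> ` {c. c ^ n = 1}" for p
  proof
    assume "p \<in> zeros (directed_cycle_generators \<omega> C)"
    then have gen: "\<And>i. 1 \<le> i \<Longrightarrow> i \<le> n - 1 \<Longrightarrow>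
          p (cycle_vertex C (n - i)) = \<omega> ^ (n - i) * p (cycle_vertex C n)"
      and last: "p (cycle_vertex C n) ^ n = 1"
      by (force simp: zeros_def directed_cycle_generators_def Let_def len)+
    \<comment> \<open>The generators are indexed backwards, hence \<open>n - i\<close>; position
      \<open>n\<close> has no linear generator and is covered by
      \<open>\<omega> ^ n = 1\<close>.\<close>
    have "p (cycle_vertex C i) = \<omega> ^ i * p (cycle_vertex C n)" if "1 \<le> i" "i \<le> n" for i
      using gen [of "n - i"] that by (cases "i = n") (simp_all add: omega_power_n)
    then have "p = labelling C \<omega> (p (cycle_vertex C n))"
      by (rule labelling_eqI [OF C])
    with last show "p \<in> labelling C \<omega> ` {c. c ^ n = 1}"
      by blast
  next
    assume "p \<in> labelling C \<omega> ` {c. c ^ n = 1}"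
    then show "p \<in> zeros (directed_cycle_generators \<omega> C)"
      using n_pos by (auto simp: zeros_def directed_cycle_generators_def Let_def len
          labelling_cycle_vertex [OF C] omega_power_n)
  qed
  then show ?thesis
    by blast
qed

text \<open>\<open>A i\<close> and \<open>B i\<close> solve this 2 by 2 linear system, which says
  that the \<open>i\<close>-th linear generator vanishes on the labellings by powers of \<omega> and
  by powers of its inverse.\<close>

lemma doubly_covered_coefficients:
  defines "A i \<equiv> (\<omega> powi (2 + int i) - \<omega> powi (2 - int i)) / (\<omega> ^ 3 - \<omega>)"
    and "B i \<equiv> (\<omega> powi (1 - int i) - \<omega> powi (3 + int i)) / (\<omega> ^ 3 - \<omega>)"
  shows "A i * \<omega> + B i = - (inverse \<omega> ^ i)" and "A i * inverse \<omega> + B i = - (\<omega> ^ i)"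
proof -
  define e where "e = \<omega> ^ i"
  have e: "e \<noteq> 0"
    using omega_nonzero by (simp add: e_def)
  have A: "A i = (\<omega>\<^sup>2 * e - \<omega>\<^sup>2 / e) / (\<omega> ^ 3 - \<omega>)"
    and B: "B i = (\<omega> / e - \<omega> ^ 3 * e) / (\<omega> ^ 3 - \<omega>)"
    using omega_nonzero by (simp_all add: A_def B_def power_int_add power_int_diff e_def)
  have D: "\<omega> ^ 3 - \<omega> \<noteq> 0"
    by (rule omega_power_3_diff)
  have "A i * \<omega> + B i =
      ((\<omega>\<^sup>2 * e - \<omega>\<^sup>2 / e) * \<omega> + (\<omega> / e - \<omega> ^ 3 * e)) / (\<omega> ^ 3 - \<omega>)"
    unfolding A B by (simp add: add_divide_distrib)
  also have "(\<omega>\<^sup>2 * e - \<omega>\<^sup>2 / e) * \<omega> + (\<omega> / e - \<omega> ^ 3 * e) = (\<omega> ^ 3 - \<omega>) * (- inverse e)"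
    using e by (simp add: field_simps power2_eq_square power3_eq_cube)
  finally show "A i * \<omega> + B i = - (inverse \<omega> ^ i)"
    by (simp only: e_def power_inverse nonzero_mult_div_cancel_left [OF D])
  have "A i * inverse \<omega> + B i =
      ((\<omega>\<^sup>2 * e - \<omega>\<^sup>2 / e) * inverse \<omega> + (\<omega> / e - \<omega> ^ 3 * e)) / (\<omega> ^ 3 - \<omega>)"
    unfolding A B by (simp add: add_divide_distrib)
  also have "(\<omega>\<^sup>2 * e - \<omega>\<^sup>2 / e) * inverse \<omega> + (\<omega> / e - \<omega> ^ 3 * e) = (\<omega> ^ 3 - \<omega>) * (- e)"
    using e omega_nonzero by (simp add: field_simps power2_eq_square power3_eq_cube)
  finally show "A i * inverse \<omega> + B i = - (\<omega> ^ i)"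
    by (simp only: e_def nonzero_mult_div_cancel_left [OF D])
qed

text \<open>The quadratic generator allows two ratios between the labels of the last two vertices,
  and each ratio determines all other labels through the linear generators.\<close>

lemma zeros_doubly_covered_cycle_generators:
  assumes C: "C \<in> hamiltonian_cycles G"
  shows "zeros (doubly_covered_cycle_generators \<omega> C) =
    labelling C \<omega> ` {c. c ^ n = 1} \<union> labelling C (inverse \<omega>) ` {c. c ^ n = 1}"
    (is "?Z = ?R")
proof -
  have len: "length C = n"
    using C by (simp add: hamiltonian_cycles_iff)
  define A where "A i = (\<omega> powi (2 + int i) - \<omega> powi (2 - int i)) / (\<omega> ^ 3 - \<omega>)" for i
  define B where "B i = (\<omega> powi (1 - int i) - \<omega> powi (3 + int i)) / (\<omega> ^ 3 - \<omega>)" for i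
  have coeffs: "A i * \<omega> + B i = - (inverse \<omega> ^ i)" "A i * inverse \<omega> + B i = - (\<omega> ^ i)" for i
    unfolding A_def B_def by (rule doubly_covered_coefficients)+
  have Z: "p \<in> ?Z \<longleftrightarrow>
      (\<forall>i. 1 \<le> i \<and> i \<le> n - 2 \<longrightarrow> p (cycle_vertex C i) + A i * p (cycle_vertex C (n - 1))
            + B i * p (cycle_vertex C n) = 0) \<and>
      (p (cycle_vertex C (n - 1)) = \<omega> * p (cycle_vertex C n) \<or>
       p (cycle_vertex C (n - 1)) = inverse \<omega> * p (cycle_vertex C n)) \<and>
      p (cycle_vertex C n) ^ n = 1" for p
    by (auto simp: zeros_def doubly_covered_cycle_generators_def Let_def len A_def B_def
        simp del: One_nat_def)
  have shift: "\<omega> ^ (n - 1) = inverse \<omega>" "inverse \<omega> ^ (n - 1) = \<omega>"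
    using omega_power_n inverse_omega_power_n omega_nonzero n_pos
    by (simp_all add: power_diff inverse_eq_divide)
  have "p \<in> ?Z \<longleftrightarrow> p \<in> ?R" for p
  proof
    assume "p \<in> ?Z"
    then have gen0: "\<And>i. 1 \<le> i \<Longrightarrow> i \<le> n - 2 \<Longrightarrow> p (cycle_vertex C i)
          + A i * p (cycle_vertex C (n - 1)) + B i * p (cycle_vertex C n) = 0"
      and last: "p (cycle_vertex C n) ^ n = 1"
      and or: "p (cycle_vertex C (n - 1)) = \<omega> * p (cycle_vertex C n) \<or>
        p (cycle_vertex C (n - 1)) = inverse \<omega> * p (cycle_vertex C n)"
      unfolding Z by blast+
    have gen: "p (cycle_vertex C i) =
          - (A i * p (cycle_vertex C (n - 1)) + B i * p (cycle_vertex C n))"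
      if "1 \<le> i" "i \<le> n - 2" for i
      using gen0 [OF that] by (simp only: add.assoc add_eq_0_iff2)
    from or show "p \<in> ?R"
    proof
      \<comment> \<open>Here a step backwards from the last vertex multiplies by \<omega>, so
        forward steps multiply by its inverse.\<close>
      assume *: "p (cycle_vertex C (n - 1)) = \<omega> * p (cycle_vertex C n)"
      have "p (cycle_vertex C i) = inverse \<omega> ^ i * p (cycle_vertex C n)"
        if i: "1 \<le> i" "i \<le> n" for i
      proof -
        consider "i \<le> n - 2" | "i = n - 1" | "i = n"
          using i by linarith
        then show ?thesis
        proof cases
          case 1
          have "p (cycle_vertex C i) = - (A i * \<omega> + B i) * p (cycle_vertex C n)"
            using gen [OF i(1) 1] * by (simp add: algebra_simps)
          then show ?thesis
            by (simp add: coeffs)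
        qed (simp_all add: * shift inverse_omega_power_n del: One_nat_def)
      qed
      then have "p = labelling C (inverse \<omega>) (p (cycle_vertex C n))"
        by (rule labelling_eqI [OF C])
      with last show ?thesis
        by blast
    next
      assume *: "p (cycle_vertex C (n - 1)) = inverse \<omega> * p (cycle_vertex C n)"
      have "p (cycle_vertex C i) = \<omega> ^ i * p (cycle_vertex C n)"
        if i: "1 \<le> i" "i \<le> n" for i
      proof -
        consider "i \<le> n - 2" | "i = n - 1" | "i = n"
          using i by linarith
        then show ?thesis
        proof cases
          case 1
          have "p (cycle_vertex C i) = - (A i * inverse \<omega> + B i) * p (cycle_vertex C n)"
            using gen [OF i(1) 1] * by (simp add: algebra_simps)
          then show ?thesis
            by (simp add: coeffs)
        qed (simp_all add: * shift omega_power_n del: One_nat_def)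
      qed
      then have "p = labelling C \<omega> (p (cycle_vertex C n))"
        by (rule labelling_eqI [OF C])
      with last show ?thesis
        by blast
    qed
  next
    have n: "1 \<le> n - 1" "n - 1 \<le> n" "1 \<le> n" "n \<le> n" "n - 2 \<le> n"
      using n_ge_3 by simp_all
    note lab = labelling_cycle_vertex [OF C]
    assume "p \<in> ?R"
    then obtain c where c: "c ^ n = 1" and "p = labelling C \<omega> c \<or> p = labelling C (inverse \<omega>) c"
      by blast
    from this(2) show "p \<in> ?Z"
    proof
      assume p: "p = labelling C \<omega> c"
      have "p (cycle_vertex C i) + A i * (inverse \<omega> * c) + B i * c = 0"
        if "1 \<le> i" "i \<le> n - 2" for i
      proof -
        have "p (cycle_vertex C i) + A i * (inverse \<omega> * c) + B i * c
            = (\<omega> ^ i + (A i * inverse \<omega> + B i)) * c"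
          using that n by (simp add: p lab algebra_simps)
        then show ?thesis
          by (simp add: coeffs)
      qed
      moreover have "p (cycle_vertex C n) = c" "p (cycle_vertex C (n - 1)) = inverse \<omega> * c"
        using n by (simp_all add: p lab shift omega_power_n del: One_nat_def)
      ultimately show ?thesis
        unfolding Z using c by simp
    next
      assume p: "p = labelling C (inverse \<omega>) c"
      have "p (cycle_vertex C i) + A i * (\<omega> * c) + B i * c = 0"
        if "1 \<le> i" "i \<le> n - 2" for i
      proof -
        have "p (cycle_vertex C i) + A i * (\<omega> * c) + B i * c
            = (inverse \<omega> ^ i + (A i * \<omega> + B i)) * c"
          using that n by (simp add: p lab algebra_simps)
        then show ?thesis
          by (simp add: coeffs)
      qed
      moreover have "p (cycle_vertex C n) = c" "p (cycle_vertex C (n - 1)) = \<omega> * c"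
        using n by (simp_all add: p lab shift inverse_omega_power_n del: One_nat_def)
      ultimately show ?thesis
        unfolding Z using c by simp
    qed
  qed
  then show ?thesis
    by blast
qed

text \<open>Each family contributes \<open>n\<close> labellings. A common member would give
  \<open>c = d\<close> at the last vertex and then \<open>\<omega> = inverse \<omega>\<close> at the
  first.\<close>

lemma card_zeros_cycle_generators:
  assumes C: "C \<in> hamiltonian_cycles G"
  shows "card (zeros (cycle_generators C)) = (if doubly_covered_cycle G C then 2 * n else n)"
proof -
  have card: "card (labelling C \<epsilon> ` {c. c ^ n = 1}) = n" if "\<epsilon> ^ n = 1" for \<epsilon>
    using inj_labelling [OF C that] roots_of_unity_eq(3) [OF prim n_pos]
    by (simp add: card_image inj_on_subset)
  have "labelling C \<omega> ` {c. c ^ n = 1} \<inter> labelling C (inverse \<omega>) ` {c. c ^ n = 1} = {}"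
  proof (rule ccontr)
    assume "\<not> ?thesis"
    then obtain c d where c: "c ^ n = 1" and eq: "labelling C \<omega> c = labelling C (inverse \<omega>) d"
      by blast
    have "c \<noteq> 0"
      using c n_pos by (auto simp: zero_power)
    moreover have "c = d"
      using fun_cong [OF eq, of "cycle_vertex C n"] n_pos
      by (simp add: labelling_cycle_vertex [OF C] omega_power_n inverse_omega_power_n)
    ultimately show False
      using fun_cong [OF eq, of "cycle_vertex C 1"] n_pos omega_neq_inverse
      by (simp add: labelling_cycle_vertex [OF C])
  qed
  then show ?thesis
    using card [OF omega_power_n] card [OF inverse_omega_power_n] roots_of_unity_eq(2) [OF prim n_pos]
    by (simp add: cycle_generators_def zeros_directed_cycle_generators [OF C]
        zeros_doubly_covered_cycle_generators [OF C] card_Un_disjoint)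
qed

section \<open>Zeros of the cycle ideal are zeros of the Hamiltonian ideal\<close>

lemma labelling_omega_mem_zeros:
  assumes C: "C \<in> hamiltonian_cycles G" and c: "c ^ n = 1"
  shows "labelling C \<omega> c \<in> zeros hamiltonian_generators"
  unfolding zeros_hamiltonian_generators
proof (intro conjI allI)
  fix v
  obtain i where i: "1 \<le> i" "i \<le> n" "v = cycle_vertex C i"
    by (rule cycle_vertex_cases [OF C])
  show "labelling C \<omega> c v ^ n = 1"
    using i c by (simp add: labelling_cycle_vertex [OF C] power_mult_distrib omega_power_power)
  have "(v, cycle_vertex C (Suc (i mod n))) \<in> parcs G"
    using cycle_vertex_arc [OF C i(1,2)] C i(3) by (auto simp: hamiltonian_cycles_iff)
  moreover have "labelling C \<omega> c (cycle_vertex C (Suc (i mod n))) = \<omega> * labelling C \<omega> c v"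
    using i n_pos
    by (simp add: labelling_cycle_vertex [OF C] omega_power_mod Suc_leI mult.assoc)
  ultimately show "\<exists>j. (v, j) \<in> parcs G \<and> labelling C \<omega> c j = \<omega> * labelling C \<omega> c v"
    by blast
qed

text \<open>The required out-neighbour is the predecessor on the cycle, reached by the reversed arc
  that double covering provides.\<close>

lemma labelling_inverse_omega_mem_zeros:
  assumes C: "C \<in> hamiltonian_cycles G" and dc: "doubly_covered_cycle G C" and c: "c ^ n = 1"
  shows "labelling C (inverse \<omega>) c \<in> zeros hamiltonian_generators"
  unfolding zeros_hamiltonian_generators
proof (intro conjI allI)
  fix v
  obtain i where i: "1 \<le> i" "i \<le> n" "v = cycle_vertex C i"
    by (rule cycle_vertex_cases [OF C])
  show "labelling C (inverse \<omega>) c v ^ n = 1"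
    using i c
    by (simp add: labelling_cycle_vertex [OF C] power_mult_distrib power_inverse omega_power_power)
  \<comment> \<open>The position of the predecessor, wrapping around from 1 to
    \<open>n\<close>.\<close>
  define j where "j = (if i = 1 then n else i - 1)"
  have j: "1 \<le> j" "j \<le> n" "Suc (j mod n) = i"
    using i by (auto simp: j_def)
  have "(v, cycle_vertex C j) \<in> parcs G"
    using cycle_vertex_arc [OF C j(1,2)] dc unfolding j(3) i(3) doubly_covered_cycle_def by blast
  moreover have "labelling C (inverse \<omega>) c (cycle_vertex C j) = \<omega> * labelling C (inverse \<omega>) c v"
  proof -
    have "inverse \<omega> ^ j = inverse \<omega> ^ (i - 1)"
      by (simp add: j_def inverse_omega_power_n)
    also have "\<dots> = \<omega> * inverse \<omega> ^ i"
      using i(1) omega_nonzero by (cases i) simp_all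
    finally show ?thesis
      using i j by (simp add: labelling_cycle_vertex [OF C] mult.assoc)
  qed
  ultimately show "\<exists>j. (v, j) \<in> parcs G \<and>
      labelling C (inverse \<omega>) c j = \<omega> * labelling C (inverse \<omega>) c v"
    by blast
qed

lemma zeros_cycle_generators_subset:
  assumes C: "C \<in> hamiltonian_cycles G"
  shows "zeros (cycle_generators C) \<subseteq> zeros hamiltonian_generators"
  using labelling_omega_mem_zeros [OF C] labelling_inverse_omega_mem_zeros [OF C]
  by (auto simp: cycle_generators_def zeros_directed_cycle_generators [OF C]
      zeros_doubly_covered_cycle_generators [OF C])

text \<open>With finiteness, inclusion and equal cardinality give equality of the zero sets.\<close>

lemma finite_zeros_hamiltonian_generators: "finite (zeros hamiltonian_generators)"
proof (rule finite_subset)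
  show "zeros hamiltonian_generators \<subseteq> UNIV \<rightarrow>\<^sub>E {c. c ^ n = 1}"
    by (auto simp: zeros_hamiltonian_generators PiE_def)
  show "finite (UNIV \<rightarrow>\<^sub>E {c::'a. c ^ n = 1} :: ('v \<Rightarrow> 'a) set)"
    using roots_of_unity_eq(2) [OF prim n_pos] by (intro finite_PiE) simp_all
qed

section \<open>Cycle ideals contain all polynomials vanishing on their zeros\<close>

lemma zero_determined_directed_cycle_generators:
  assumes C: "C \<in> hamiltonian_cycles G"
  shows "zero_determined (directed_cycle_generators \<omega> C)" (is "zero_determined ?B")
proof (rule zero_determined_split)
  have len: "length C = n"
    using C by (simp add: hamiltonian_cycles_iff)
  let ?y = "var (cycle_vertex C n) :: ('v, 'a) mpoly"
  show "finite {a::'a. a ^ n = 1}"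
    by (rule roots_of_unity_eq(2) [OF prim n_pos])
  show "(\<Prod>a | a ^ n = 1. ?y - const a) \<in> ideal ?B"
    unfolding prod_roots_of_unity [OF prim n_pos]
    by (rule ideal_base) (simp add: directed_cycle_generators_def Let_def len)
  \<comment> \<open>Once the last variable is fixed, the linear generators make every other variable
    constant.\<close>
  show "zero_determined (insert (?y - const a) ?B)" for a
  proof (rule zero_determined_point)
    fix v
    let ?I = "ideal (insert (?y - const a) ?B)"
    obtain i where i: "1 \<le> i" "i \<le> n" "v = cycle_vertex C i"
      by (rule cycle_vertex_cases [OF C])
    show "\<exists>c. var v - const c \<in> ?I"
    proof (cases "i = n")
      case True
      then show ?thesis
        using i(3) by (blast intro: ideal_base)
    next
      case False
      have "var v - const (\<omega> ^ i) * ?y =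
          var (cycle_vertex C (n - (n - i))) - const (\<omega> ^ (n - (n - i))) * ?y"
        using i by simp
      also have "\<dots> \<in> ?B"
        unfolding directed_cycle_generators_def Let_def len using i False
        by (intro UnI1 CollectI exI [of _ "n - i"]) auto
      finally have "(var v - const (\<omega> ^ i) * ?y) + const (\<omega> ^ i) * (?y - const a) \<in> ?I"
        by (intro ideal_add ideal_mult ideal_base) simp_all
      then have "var v - const (\<omega> ^ i * a) \<in> ?I"
        by (simp add: const_mult algebra_simps)
      then show ?thesis ..
    qed
  qed
qed

text \<open>Two nested splits: by the value \<open>a\<close> of the last variable, then by the two
  values \<open>\<omega> * a\<close> and \<open>inverse \<omega> * a\<close> of the one before it.
  The linear generators fix the rest.\<close>

lemma zero_determined_doubly_covered_cycle_generators:
  assumes C: "C \<in> hamiltonian_cycles G"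
  shows "zero_determined (doubly_covered_cycle_generators \<omega> C)" (is "zero_determined ?B")
proof (rule zero_determined_split)
  have len: "length C = n"
    using C by (simp add: hamiltonian_cycles_iff)
  let ?y = "var (cycle_vertex C n) :: ('v, 'a) mpoly"
  let ?x = "var (cycle_vertex C (n - 1)) :: ('v, 'a) mpoly"
  show "finite {a::'a. a ^ n = 1}"
    by (rule roots_of_unity_eq(2) [OF prim n_pos])
  show "(\<Prod>a | a ^ n = 1. ?y - const a) \<in> ideal ?B"
    unfolding prod_roots_of_unity [OF prim n_pos]
    by (rule ideal_base) (simp add: doubly_covered_cycle_generators_def Let_def len)
  fix a :: 'a
  assume "a \<in> {a. a ^ n = 1}"
  then have "a \<noteq> 0"
    using n_pos by (auto simp: zero_power)
  let ?B' = "insert (?y - const a) ?B"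
  show "zero_determined ?B'"
  proof (rule zero_determined_split)
    show "finite {\<omega> * a, inverse \<omega> * a}"
      by simp
    have "(?x - const \<omega> * ?y) * (?x - const (inverse \<omega>) * ?y) \<in> ?B'"
      by (simp add: doubly_covered_cycle_generators_def Let_def len)
    \<comment> \<open>The added multiple of \<open>?y - const a\<close> is the telescoped difference
      of the two products; it replaces \<open>?y\<close> by \<open>const a\<close> in the quadratic
      generator.\<close>
    then have "(?x - const \<omega> * ?y) * (?x - const (inverse \<omega>) * ?y)
        + ((?x - const \<omega> * ?y) * const (inverse \<omega>) + const \<omega> * (?x - const (inverse \<omega>) * const a))
          * (?y - const a) \<in> ideal ?B'"
      by (intro ideal_add ideal_mult ideal_base) simp_all
    also have "(?x - const \<omega> * ?y) * (?x - const (inverse \<omega>) * ?y)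
        + ((?x - const \<omega> * ?y) * const (inverse \<omega>) + const \<omega> * (?x - const (inverse \<omega>) * const a))
          * (?y - const a)
        = (?x - const \<omega> * const a) * (?x - const (inverse \<omega>) * const a)"
      by (simp add: algebra_simps)
    \<comment> \<open>The index set has two different elements because
      \<open>\<omega> \<noteq> inverse \<omega>\<close> and \<open>a \<noteq> 0\<close>.\<close>
    also have "\<dots> = (\<Prod>b\<in>{\<omega> * a, inverse \<omega> * a}. ?x - const b)"
      using omega_neq_inverse \<open>a \<noteq> 0\<close> by (simp add: const_mult)
    finally show "(\<Prod>b\<in>{\<omega> * a, inverse \<omega> * a}. ?x - const b) \<in> ideal ?B'" .
    show "zero_determined (insert (?x - const b) ?B')" for b
    proof (rule zero_determined_point)
      fix v
      let ?I = "ideal (insert (?x - const b) ?B')"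
      obtain i where i: "1 \<le> i" "i \<le> n" "v = cycle_vertex C i"
        by (rule cycle_vertex_cases [OF C])
      then consider "i \<le> n - 2" | "i = n - 1" | "i = n"
        by linarith
      then show "\<exists>c. var v - const c \<in> ?I"
      proof cases
        case 1
        define A where "A = (\<omega> powi (2 + int i) - \<omega> powi (2 - int i)) / (\<omega> ^ 3 - \<omega>)"
        define B where "B = (\<omega> powi (1 - int i) - \<omega> powi (3 + int i)) / (\<omega> ^ 3 - \<omega>)"
        have "var v + const A * ?x + const B * ?y \<in> ?B"
          unfolding doubly_covered_cycle_generators_def Let_def len A_def B_def i(3) using i 1
          by blast
        then have "(var v + const A * ?x + const B * ?y)
            - (const A * (?x - const b) + const B * (?y - const a)) \<in> ?I"
          by (intro ideal_add ideal_diff ideal_mult ideal_base) simp_all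
        then have "var v - const (- (A * b + B * a)) \<in> ?I"
          by (simp add: const_mult const_add const_diff const_uminus algebra_simps)
        then show ?thesis ..
      qed (use i(3) in \<open>blast intro: ideal_base\<close>)+
    qed
  qed
qed

lemma zero_determined_cycle_generators:
  assumes "C \<in> hamiltonian_cycles G"
  shows "zero_determined (cycle_generators C)"
  using assms zero_determined_directed_cycle_generators
    zero_determined_doubly_covered_cycle_generators
  by (simp add: cycle_generators_def)

section \<open>Comparing the two ideals by counting zeros\<close>

lemma card_hamiltonian_cycles:
  "card (hamiltonian_cycles G) = card (zeros hamiltonian_generators)"
  using bij_betw_same_card [OF bij_betw_cycle_of_zero] ..

text \<open>One inclusion of zero sets holds for every Hamiltonian cycle, so equality of the ideals
  comes down to equal numbers of zeros.\<close>

lemma hamiltonian_ideal_eq_cycle_ideal_iff: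
  assumes C: "C \<in> hamiltonian_cycles G"
  shows "hamiltonian_ideal \<omega> G = cycle_ideal \<omega> G C \<longleftrightarrow>
    card (hamiltonian_cycles G) = (if doubly_covered_cycle G C then 2 * n else n)"
    (is "?I = ?J \<longleftrightarrow> _ = ?k")
proof
  assume "?I = ?J"
  then have "zeros hamiltonian_generators = zeros (cycle_generators C)"
    by (intro zeros_eq_if_ideal_eq) (simp add: hamiltonian_ideal_eq cycle_ideal_eq)
  then show "card (hamiltonian_cycles G) = ?k"
    by (simp add: card_hamiltonian_cycles card_zeros_cycle_generators [OF C])
next
  assume "card (hamiltonian_cycles G) = ?k"
  then have "zeros (cycle_generators C) = zeros hamiltonian_generators"
    by (intro card_subset_eq finite_zeros_hamiltonian_generators zeros_cycle_generators_subset C)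
      (simp add: card_hamiltonian_cycles card_zeros_cycle_generators [OF C])
  then show "?I = ?J"
    using zero_determined_hamiltonian_generators zero_determined_cycle_generators [OF C]
    unfolding hamiltonian_ideal_eq cycle_ideal_eq
    by (intro equalityI ideal_subset_if_zeros_subset) simp_all
qed

end

theorem corollary3p10:
  fixes G :: "'v::finite pair_pre_digraph"
    and \<omega> :: "'a::alg_closed_field"
    and n :: nat
  assumes "pair_digraph G"
    and "pverts G = UNIV"
    and "n = card (pverts G)"
    and "n \<ge> 3"
    and "Digraph_Component.connected (with_proj G)"
    and "CHAR('a) = 0 \<or> coprime CHAR('a) n"
    and "primitive_root_of_unity n \<omega>"
  shows "uniquely_hamiltonian G \<longleftrightarrow>
           (\<exists>C. pre_digraph.cycle (with_proj G) C \<and> length C = n \<and>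
                hamiltonian_ideal \<omega> G = cycle_ideal \<omega> G C)"
proof -
  interpret labelled_graph G \<omega> n
    using assms by unfold_locales simp_all
  \<comment> \<open>The equivalence holds for each Hamiltonian cycle separately, so the same
    \<open>C\<close> is a witness for both sides.\<close>
  have "uniquely_hamiltonian G \<longleftrightarrow>
      (\<exists>C\<in>hamiltonian_cycles G. hamiltonian_ideal \<omega> G = cycle_ideal \<omega> G C)"
    using hamiltonian_ideal_eq_cycle_ideal_iff
    by (simp add: uniquely_hamiltonian_def flip: assms(3))
  then show ?thesis
    by (auto simp: hamiltonian_cycles_def assms(3))
qed

end
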